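(* Let $y \sim N(\mu, \sigma^2 I_n)$ with $\mu=\mu(X)\in\mathbb{R}^n$ and $\sigma^2>0$ fixed, let $\hat M:\mathbb{R}^n\to\mathcal{M}$ be a measurable selection map into a finite set $\mathcal{M}$, and for each $M\in\mathcal{M}$ let $H_M\in\mathbb{R}^{n\times n}$ be a fixed (non-random) matrix. For $\alpha>0$ let $\omega\sim N(0,\alpha\sigma^2 I_n)$ be independent of $y$, and put $y^*=y+\omega$, $y^-=y-\frac1\alpha\omega$. Then for every $\alpha>0$ the estimator $$\widehat{\mathrm{Err}}_{\alpha} = \left\|y^- - H_{\hat M(y^* )}\, y\right\|_2^2 + 2\,\mathrm{tr}\!\left(H_{\hat M(y^* )}\right)\sigma^2 - \frac{1}{\alpha} n\sigma^2$$ is unbiased for $\mathrm{Err}_\alpha$, i.e. $\mathbb{E}[\widehat{\mathrm{Err}}_\alpha]=\mathrm{Err}_\alpha$, where $$\mathrm{Err}_\alpha=\mathbb{E}\left[\left\|y_{new}-H_{\hat M(y+\omega)}\,y\right\|_2^2\right],\qquad y_{new}\sim N(\mu,\sigma^2 I_n)\ \text{independent of } (y,\omega).$$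
   Context: The feature matrix $X\in\mathbb{R}^{n\times p}$ is fixed, and the mean $\mu(X)\in\mathbb{R}^n$ is an arbitrary fixed vector (not necessarily linear in $X$). The variance $\sigma^2$ is known and fixed. The set $\mathcal{M}$ is a finite collection of "models"; the hat matrix depends on the data only through the selected model. *)

theory Defs
  imports "HOL-Probability.Probability"
begin

text \<open>Density of \<open>N(\<mu>, S)\<close> on \<open>\<real>\<^sup>n\<close>, meaningful for symmetric positive definite \<open>S\<close>.\<close>

definition mvn_density :: "real^'n \<Rightarrow> real^'n^'n \<Rightarrow> real^'n \<Rightarrow> real" where
  "mvn_density \<mu> S x =
     exp (- ((x - \<mu>) \<bullet> (matrix_inv S *v (x - \<mu>))) / 2) / sqrt ((2 * pi) ^ CARD('n) * det S)"

text \<open>The library's \<open>indep_var\<close> forces both random variables to have the same value type;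
  this is the same notion without that restriction.\<close>

definition indep_rv ::
  "'a measure \<Rightarrow> 'b measure \<Rightarrow> ('a \<Rightarrow> 'b) \<Rightarrow> 'c measure \<Rightarrow> ('a \<Rightarrow> 'c) \<Rightarrow> bool" where
  "indep_rv P S U T V \<longleftrightarrow>
     U \<in> P \<rightarrow>\<^sub>M S \<and> V \<in> P \<rightarrow>\<^sub>M T \<and>
     prob_space.indep_set P {U -` A \<inter> space P | A. A \<in> sets S} {V -` B \<inter> space P | B. B \<in> sets T}"

text \<open>The estimator as a function of the realised values \<open>y\<close> and \<open>w\<close> of the data and of the
  randomisation noise; \<open>y + w\<close> is \<open>y\<^sup>*\<close> and \<open>y - (1 / \<alpha>) *\<^sub>R w\<close> is \<open>y\<^sup>-\<close>.\<close>

definition err_hat ::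
  "('m \<Rightarrow> real^'n^'n) \<Rightarrow> (real^'n \<Rightarrow> 'm) \<Rightarrow> real \<Rightarrow> real \<Rightarrow> real^'n \<Rightarrow> real^'n \<Rightarrow> real" where
  "err_hat H Mhat \<sigma> \<alpha> y w =
     (norm ((y - (1 / \<alpha>) *\<^sub>R w) - H (Mhat (y + w)) *v y))\<^sup>2
     + 2 * trace (H (Mhat (y + w))) * \<sigma>\<^sup>2 - 1 / \<alpha> * real CARD('n) * \<sigma>\<^sup>2"

end

theory Submission
  imports Defs
begin

text \<open>The selection statistic \<open>u = y + \<omega>\<close> and the vector
  \<open>z = (\<alpha> (y - \<mu>) - \<omega>) / (1 + \<alpha>)\<close> are independent Gaussians, because the product of the
  densities of \<open>y\<close> and \<open>\<omega>\<close> factors into those of \<open>z\<close> and \<open>u\<close>. Moreover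
  \<open>y\<^sup>- = \<mu> + ((1 + \<alpha>) / \<alpha>) z\<close>, whereas \<open>y\<close> is \<open>z\<close> plus a function of \<open>u\<close>. Hence the cross term
  \<open>E (y\<^sup>- \<bullet> H y)\<close> exceeds \<open>\<mu> \<bullet> E (H y)\<close>, its counterpart for \<open>y\<^sub>n\<^sub>e\<^sub>w\<close>, exactly by
  \<open>\<sigma>\<^sup>2 E (tr H)\<close>, and the remaining correction \<open>n \<sigma>\<^sup>2 / \<alpha>\<close> is the excess variance of \<open>y\<^sup>-\<close>.\<close>

section \<open>Gaussian densities with scalar covariance\<close>

lemma matrix_inv_scaleR_mat_1:
  fixes s :: real
  assumes "s \<noteq> 0"
  shows "matrix_inv (s *\<^sub>R mat 1 :: real^'n^'n) = (1 / s) *\<^sub>R mat 1"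
proof -
  have *: "(a *\<^sub>R mat 1 :: real^'n^'n) ** (b *\<^sub>R mat 1) = (a * b) *\<^sub>R mat 1" for a b
    by (simp add: matrix_scalar_ac scalar_matrix_assoc flip: scalar_mult_eq_scaleR)
  have "(s *\<^sub>R mat 1 :: real^'n^'n) ** ((1 / s) *\<^sub>R mat 1) = mat 1"
    "((1 / s) *\<^sub>R mat 1 :: real^'n^'n) ** (s *\<^sub>R mat 1) = mat 1"
    using assms by (simp_all add: *)
  \<comment> \<open>\<open>matrix_inv\<close> is a choice operator, so exhibiting an inverse is not
    enough: uniqueness of two-sided inverses, by associativity, pins the choice down.\<close>
  then show ?thesis
    unfolding matrix_inv_def
    by (intro some_equality) (metis matrix_mul_assoc matrix_mul_lid matrix_mul_rid)+
qed

lemma det_scaleR_mat_1: "det (s *\<^sub>R mat 1 :: real^'n^'n) = s ^ CARD('n)"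
  by (subst det_diagonal) (auto simp: mat_def)

text \<open>This closed form removes \<open>matrix_inv\<close> and \<open>det\<close>; nonnegativity
  and measurability of the density are read off from it.\<close>

lemma mvn_density_isotropic:
  fixes m x :: "real^'n"
  assumes "s > 0"
  shows "mvn_density m (s *\<^sub>R mat 1) x =
    exp (- (norm (x - m))\<^sup>2 / (2 * s)) / sqrt ((2 * pi * s) ^ CARD('n))"
proof -
  have "((1 / s) *\<^sub>R mat 1 :: real^'n^'n) *v v = (1 / s) *\<^sub>R v" for v :: "real^'n"
    by (simp add: scaleR_matrix_vector_assoc[symmetric])
  then show ?thesis
    using assms by (simp add: mvn_density_def matrix_inv_scaleR_mat_1 det_scaleR_mat_1
      power2_norm_eq_inner power_mult_distrib mult_ac)
qed

text \<open>The squared norm in the exponent is a sum over coordinates, so the exponential splits.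
  \<open>normal_density\<close> takes a standard deviation, hence \<open>sqrt s\<close>. This
  reduces all moments to dimension one.\<close>

lemma mvn_density_isotropic_prod:
  fixes m x :: "real^'n"
  assumes "s > 0"
  shows "mvn_density m (s *\<^sub>R mat 1) x = (\<Prod>i\<in>UNIV. normal_density (m $ i) (sqrt s) (x $ i))"
proof -
  have "(norm (x - m))\<^sup>2 = (\<Sum>i\<in>UNIV. (x $ i - m $ i)\<^sup>2)"
    by (simp add: power2_norm_eq_inner inner_vec_def flip: power2_eq_square)
  then have "exp (- (norm (x - m))\<^sup>2 / (2 * s)) = (\<Prod>i\<in>UNIV. exp (- (x $ i - m $ i)\<^sup>2 / (2 * s)))"
    by (simp add: exp_sum[symmetric] sum_divide_distrib sum_negf)
  then show ?thesis
    using assms by (simp add: mvn_density_isotropic normal_density_def prod_dividef prod.distrib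
        power_one_over real_sqrt_power[symmetric])
qed

section \<open>Moments of an isotropic Gaussian vector\<close>

lemma has_bochner_integral_lborel_vec_prod:
  fixes h :: "'n::finite \<Rightarrow> real \<Rightarrow> real"
  assumes "\<And>i. integrable lborel (h i)"
  shows "has_bochner_integral lborel (\<lambda>x::real^'n. \<Prod>i\<in>UNIV. h i (x $ i)) (\<Prod>i\<in>UNIV. \<integral>x. h i x \<partial>lborel)"
proof -
  \<comment> \<open>Lebesgue measure on \<open>real^'n\<close> is the image of a product measure
    indexed by \<open>Basis\<close>, while the factors \<open>h i\<close> are indexed by
    \<open>'n\<close>. The map \<open>k\<close> inverts the bijection from \<open>i\<close> to
    \<open>axis i 1\<close>, along which the product integral is transported.\<close>
  define k :: "real^'n \<Rightarrow> 'n" where "k = inv (\<lambda>i. axis i 1)"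
  have inj: "inj (\<lambda>i::'n. axis i (1::real))"
    by (auto simp: inj_def axis_eq_axis)
  have k: "k (axis i 1) = i" for i
    unfolding k_def using inj by (rule inv_f_f)
  have re: "(\<Prod>b\<in>Basis. f b) = (\<Prod>i\<in>UNIV. f (axis i 1))" for f :: "real^'n \<Rightarrow> real"
    by (simp add: Basis_vec_def UNION_singleton_eq_range prod.reindex inj)
  interpret product_sigma_finite "\<lambda>_::real^'n. lborel :: real measure" ..
  let ?T = "\<lambda>f. \<Sum>b\<in>Basis. f b *\<^sub>R (b :: real^'n)"
  have T: "?T \<in> (\<Pi>\<^sub>M b\<in>Basis. lborel) \<rightarrow>\<^sub>M borel" by simp
  have [measurable]: "h i \<in> borel_measurable borel" for i
    using borel_measurable_integrable[OF assms[of i]] by simp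
  have comp: "?T f $ i = f (axis i 1)" for f i
    by (simp add: cart_eq_inner_axis inner_sum_left inner_Basis if_distrib sum.delta cong: if_cong)
  have "has_bochner_integral (\<Pi>\<^sub>M b\<in>Basis. lborel) (\<lambda>f. \<Prod>b\<in>Basis. h (k b) (f b))
      (\<Prod>b\<in>Basis. \<integral>x. h (k b) x \<partial>lborel)"
    using product_integrable_prod[of Basis "\<lambda>b. h (k b)"] product_integral_prod[of Basis "\<lambda>b. h (k b)"] assms
    by (simp add: has_bochner_integral_iff)
  then have "has_bochner_integral (\<Pi>\<^sub>M b\<in>Basis. lborel) (\<lambda>f. \<Prod>i\<in>UNIV. h i (?T f $ i))
      (\<Prod>i\<in>UNIV. \<integral>x. h i x \<partial>lborel)"
    by (simp add: re k comp del: sum_component)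
  then show ?thesis
    by (subst lborel_eq, intro has_bochner_integral_distr T) auto
qed

text \<open>Density and monomial both factor over the coordinates, so a mixed central moment is a
  product of one-dimensional ones.\<close>

lemma distributed_mvn_moment:
  fixes X :: "'a \<Rightarrow> real^'n"
  assumes X: "distributed P lborel X (mvn_density m (s *\<^sub>R mat 1))" and s: "s > 0"
  shows "has_bochner_integral P (\<lambda>x. \<Prod>i\<in>UNIV. (X x $ i - m $ i) ^ k i)
    (\<Prod>i\<in>UNIV. \<integral>t. normal_density (m $ i) (sqrt s) t * (t - m $ i) ^ k i \<partial>lborel)"
proof -
  let ?f = "mvn_density m (s *\<^sub>R mat 1)" and ?g = "\<lambda>x::real^'n. \<Prod>i\<in>UNIV. (x $ i - m $ i) ^ k i"
  have g: "?g \<in> borel_measurable lborel" by simp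
  have f: "0 \<le> ?f x" for x
    using s by (simp add: mvn_density_isotropic)
  have "has_bochner_integral lborel (\<lambda>x. ?f x * ?g x)
      (\<Prod>i\<in>UNIV. \<integral>t. normal_density (m $ i) (sqrt s) t * (t - m $ i) ^ k i \<partial>lborel)"
    using has_bochner_integral_lborel_vec_prod
        [of "\<lambda>i t. normal_density (m $ i) (sqrt s) t * (t - m $ i) ^ k i"] s
    by (simp add: integrable_normal_moment mvn_density_isotropic_prod prod.distrib)
  then show ?thesis
    using distributed_integral[OF X g] distributed_integrable[OF X g] f
    by (simp add: has_bochner_integral_iff)
qed

text \<open>Indicator exponents pick out one coordinate; with them the general product moment
  specializes to means and covariances.\<close>

lemma prod_power_of_bool_eq:
  fixes f :: "'n::finite \<Rightarrow> real"
  shows "(\<Prod>i\<in>UNIV. f i ^ of_bool (i = a)) = f a"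
  by (simp add: of_bool_def if_distrib[of "power _"] cong: if_cong)

lemma distributed_mvn_mean:
  fixes X :: "'a \<Rightarrow> real^'n"
  assumes "prob_space P"
    and X: "distributed P lborel X (mvn_density m (s *\<^sub>R mat 1))" and s: "s > 0"
  shows "has_bochner_integral P (\<lambda>x. X x $ a) (m $ a)"
proof -
  interpret prob_space P by fact
  \<comment> \<open>The factor at \<open>i = a\<close> is the first central moment; index 0 in the
    odd-moment formula stands for exponent 1.\<close>
  have "(\<Prod>i\<in>UNIV. \<integral>t. normal_density (m $ i) (sqrt s) t * (t - m $ i) ^ of_bool (i = a) \<partial>lborel) = 0"
    using integral_normal_moment_odd[of "sqrt s" "m $ a" 0] s by (intro prod_zero) auto
  then have "has_bochner_integral P (\<lambda>x. X x $ a - m $ a) 0"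
    using distributed_mvn_moment[OF X s, of "\<lambda>i. of_bool (i = a)"]
    by (simp only: prod_power_of_bool_eq)
  then have "has_bochner_integral P (\<lambda>x. (X x $ a - m $ a) + m $ a) (0 + m $ a)"
    by (rule has_bochner_integral_add) (simp add: has_bochner_integral_iff prob_space)
  then show ?thesis by simp
qed

lemma distributed_mvn_covariance:
  fixes X :: "'a \<Rightarrow> real^'n"
  assumes X: "distributed P lborel X (mvn_density m (s *\<^sub>R mat 1))" and s: "s > 0"
  shows "has_bochner_integral P (\<lambda>x. (X x $ a - m $ a) * (X x $ b - m $ b)) (s * of_bool (a = b))"
proof -
  let ?M = "\<lambda>i k. \<integral>t. normal_density (m $ i) (sqrt s) t * (t - m $ i) ^ k \<partial>lborel"
  \<comment> \<open>The exponents are 2 at \<open>a\<close> if \<open>a = b\<close>, and 1 at both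
    indices otherwise. In the second case a vanishing first central moment kills the
    product.\<close>
  let ?k = "\<lambda>i. of_bool (i = a) + of_bool (i = b) :: nat"
  have M: "?M i 0 = 1" "?M i (Suc 0) = 0" "?M i 2 = s" for i
    using integral_normal_moment_odd[of "sqrt s" "m $ i" 0]
      integral_normal_moment_even[of "sqrt s" "m $ i" 1] s
    by (simp_all add: power2_eq_square)
  have "(\<Prod>i\<in>UNIV. ?M i (?k i)) = s * of_bool (a = b)"
  proof (cases "a = b")
    case True
    then have "?M i (?k i) = (if i = a then s else 1)" for i
      using M by (simp add: numeral_2_eq_2)
    then show ?thesis using True by simp
  next
    case False
    then have "?M a (?k a) = 0" using M by simp
    then have "(\<Prod>i\<in>UNIV. ?M i (?k i)) = 0" by (intro prod_zero) auto
    then show ?thesis using False by simp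
  qed
  then show ?thesis
    using distributed_mvn_moment[OF X s, of ?k]
    by (simp add: power_add prod.distrib prod_power_of_bool_eq)
qed

lemma borel_measurable_mvn_density:
  fixes m :: "real^'n"
  assumes "s > 0"
  shows "mvn_density m (s *\<^sub>R mat 1) \<in> borel_measurable borel"
  using assms by (simp add: mvn_density_isotropic cong: measurable_cong)

text \<open>Unit mass is what makes the two factors of a product density its marginals.\<close>

lemma nn_integral_mvn_density:
  fixes m :: "real^'n"
  assumes s: "s > 0"
  shows "(\<integral>\<^sup>+x. mvn_density m (s *\<^sub>R mat 1) x \<partial>lborel) = 1"
proof -
  have "has_bochner_integral lborel (mvn_density m (s *\<^sub>R mat 1)) 1"
    using has_bochner_integral_lborel_vec_prod[of "\<lambda>i. normal_density (m $ i) (sqrt s)"] s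
    by (simp add: mvn_density_isotropic_prod cong: has_bochner_integral_cong)
  then show ?thesis
    using s by (subst nn_integral_eq_integral)
      (auto simp: has_bochner_integral_iff mvn_density_isotropic)
qed

section \<open>Passing from \<open>(y, w)\<close> to the independent pair
  \<open>(z, u)\<close>\<close>

lemma nn_integral_lborel_shift:
  fixes f :: "'a::euclidean_space \<Rightarrow> ennreal"
  assumes "f \<in> borel_measurable borel"
  shows "(\<integral>\<^sup>+x. f (x + c) \<partial>lborel) = (\<integral>\<^sup>+x. f x \<partial>lborel)"
  by (subst (2) lborel_distr_plus[of c, symmetric])
     (use assms in \<open>simp add: nn_integral_distr add.commute\<close>)

text \<open>The variances on the right are those of \<open>z\<close> and \<open>u\<close>. The map
  from \<open>(a, w)\<close> to \<open>(z, u)\<close> has determinant one in each coordinate, so no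
  Jacobian factor appears.\<close>

lemma mvn_density_product_rotate:
  fixes a w m :: "real^'n"
  assumes s: "s > 0" and \<alpha>: "\<alpha> > 0"
  shows "mvn_density m (s *\<^sub>R mat 1) a * mvn_density 0 ((\<alpha> * s) *\<^sub>R mat 1) w =
    mvn_density 0 ((\<alpha> * s / (1 + \<alpha>)) *\<^sub>R mat 1) ((1 / (1 + \<alpha>)) *\<^sub>R (\<alpha> *\<^sub>R (a - m) - w)) *
    mvn_density m (((1 + \<alpha>) * s) *\<^sub>R mat 1) (a + w)"
proof -
  define b where "b = a - m"
  define r where "r = 1 + \<alpha>"
  have r: "r > 0" and \<alpha>r: "\<alpha> = r - 1" using \<alpha> by (auto simp: r_def)
  \<comment> \<open>The inner products of \<open>b\<close> and \<open>w\<close> enter the two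
    squares with coefficients \<open>- 2 * \<alpha>\<close> and \<open>2 * \<alpha>\<close> and
    cancel: this is the uncorrelatedness of \<open>z\<close> and \<open>u\<close>.\<close>
  have "r * (\<alpha> * (norm b)\<^sup>2 + (norm w)\<^sup>2) = (norm (\<alpha> *\<^sub>R b - w))\<^sup>2 + \<alpha> * (norm (b + w))\<^sup>2"
    by (simp add: power2_norm_eq_inner inner_diff inner_add inner_commute[of w b] r_def algebra_simps)
  then have e: "(norm b)\<^sup>2 / (2 * s) + (norm w)\<^sup>2 / (2 * (\<alpha> * s)) =
      (norm ((1 / r) *\<^sub>R (\<alpha> *\<^sub>R b - w)))\<^sup>2 / (2 * (\<alpha> * s / r)) + (norm (b + w))\<^sup>2 / (2 * (r * s))"
    using s \<alpha> r by (simp add: power_divide divide_simps power2_eq_square) algebra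
  have am: "a + w - m = b + w" by (simp add: b_def)
  \<comment> \<open>The normalizing constants agree because the product of the two variances is
    \<open>\<alpha> * s\<^sup>2\<close> on both sides.\<close>
  have c: "sqrt ((2 * pi * s) ^ CARD('n)) * sqrt ((2 * pi * (\<alpha> * s)) ^ CARD('n)) =
      sqrt ((2 * pi * (\<alpha> * s / r)) ^ CARD('n)) * sqrt ((2 * pi * (r * s)) ^ CARD('n))"
    using r by (simp add: real_sqrt_mult[symmetric] power_mult_distrib[symmetric] mult_ac)
  show ?thesis
    unfolding r_def[symmetric] b_def[symmetric]
    using s \<alpha> r arg_cong[OF e, of "\<lambda>x. exp (- x)"]
    by (simp add: mvn_density_isotropic am c exp_add[symmetric] flip: b_def)
qed

text \<open>Two translations, each under the inner integral, replace the linear change of variables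
  \<open>(y, w) \<mapsto> (z, u)\<close>.\<close>

lemma distributed_mvn_rotate:
  fixes y w :: "'a \<Rightarrow> real^'n"
  assumes "prob_space P" and s: "s > 0" and \<alpha>: "\<alpha> > 0"
    and y: "distributed P lborel y (mvn_density m (s *\<^sub>R mat 1))"
    and w: "distributed P lborel w (mvn_density 0 ((\<alpha> * s) *\<^sub>R mat 1))"
    and indep: "prob_space.indep_var P borel y borel w"
  shows "distributed P (lborel \<Otimes>\<^sub>M lborel)
    (\<lambda>x. ((1 / (1 + \<alpha>)) *\<^sub>R (\<alpha> *\<^sub>R (y x - m) - w x), y x + w x))
    (\<lambda>(a, b). ennreal (mvn_density 0 ((\<alpha> * s / (1 + \<alpha>)) *\<^sub>R mat 1) a) *
      ennreal (mvn_density m (((1 + \<alpha>) * s) *\<^sub>R mat 1) b))"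
proof -
  interpret prob_space P by fact
  let ?f = "mvn_density m (s *\<^sub>R mat 1)" and ?g = "mvn_density 0 ((\<alpha> * s) *\<^sub>R mat 1)"
  let ?f' = "mvn_density 0 ((\<alpha> * s / (1 + \<alpha>)) *\<^sub>R mat 1) :: real^'n \<Rightarrow> real"
  let ?g' = "mvn_density m (((1 + \<alpha>) * s) *\<^sub>R mat 1)"
  define Z where "Z a b = (1 / (1 + \<alpha>)) *\<^sub>R (\<alpha> *\<^sub>R (a - m) - b)" for a b :: "real^'n"
  \<comment> \<open>When the sum \<open>b\<close> is held fixed, the noise is \<open>b - a\<close>
    and \<open>Z a (b - a)\<close> is a translate of \<open>a\<close>; \<open>c b\<close> is the
    amount of that translation.\<close>
  define c where "c b = - ((1 / (1 + \<alpha>)) *\<^sub>R (b + \<alpha> *\<^sub>R m))" for b :: "real^'n"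
  have [measurable]: "c \<in> borel \<rightarrow>\<^sub>M borel"
    unfolding c_def[abs_def] by simp
  have [measurable]: "case_prod Z \<in> borel \<Otimes>\<^sub>M borel \<rightarrow>\<^sub>M borel"
    unfolding Z_def[abs_def] by simp
  have [measurable]: "?f \<in> borel_measurable borel" "?g \<in> borel_measurable borel"
    "?f' \<in> borel_measurable borel" "?g' \<in> borel_measurable borel"
    using s \<alpha> by (simp_all add: borel_measurable_mvn_density)
  have [measurable]: "y \<in> P \<rightarrow>\<^sub>M borel" "w \<in> P \<rightarrow>\<^sub>M borel"
    using distributed_measurable[OF y] distributed_measurable[OF w] by simp_all
  have nn: "0 \<le> mvn_density m' (r *\<^sub>R mat 1) x" if "r > 0" for m' x :: "real^'n" and r
    using that by (simp add: mvn_density_isotropic)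
  have Zc: "Z a (b - a) = a + c b" for a b
  proof -
    have "Z a (b - a) = (1 / (1 + \<alpha>)) *\<^sub>R ((1 + \<alpha>) *\<^sub>R a) + c b"
      by (simp add: Z_def c_def algebra_simps)
    then show ?thesis using \<alpha> by simp
  qed
  have "indep_var lborel y lborel w"
    using indep by (simp add: indep_var_eq)
  note joint = distributed_joint_indep[OF sigma_finite_lborel sigma_finite_lborel y w this]
  have "distributed P (lborel \<Otimes>\<^sub>M lborel) (\<lambda>x. (Z (y x) (w x), y x + w x))
    (\<lambda>(a, b). ennreal (?f' a) * ennreal (?g' b))"
  proof (rule distributed_jointI)
    show "(\<lambda>x. Z (y x) (w x)) \<in> P \<rightarrow>\<^sub>M lborel" "(\<lambda>x. y x + w x) \<in> P \<rightarrow>\<^sub>M lborel"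
      by simp_all
  next
    fix A B :: "(real^'n) set" assume "A \<in> sets lborel" "B \<in> sets lborel"
    then have [measurable]: "A \<in> sets borel" "B \<in> sets borel" by simp_all
    \<comment> \<open>It suffices to find the probability of rectangles \<open>A\<close> times
      \<open>B\<close>. \<open>F\<close> is the claimed joint density restricted to such a
      rectangle.\<close>
    define F where "F a b = ennreal (?f' a) * ennreal (?g' b) * indicator B b * indicator A a"
      for a b :: "real^'n"
    have [measurable]: "case_prod F \<in> borel_measurable (borel \<Otimes>\<^sub>M borel)"
      unfolding F_def[abs_def] by measurable
    have meas: "(\<lambda>p. indicator A (Z (fst p) (snd p)) * indicator B (fst p + snd p) :: ennreal)
        \<in> borel_measurable (lborel \<Otimes>\<^sub>M lborel)"
      by measurable
    have "emeasure P {x \<in> space P. Z (y x) (w x) \<in> A \<and> y x + w x \<in> B} =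
        (\<integral>\<^sup>+x. indicator A (Z (y x) (w x)) * indicator B (y x + w x) \<partial>P)"
    proof -
      have "{x \<in> space P. Z (y x) (w x) \<in> A \<and> y x + w x \<in> B} \<in> sets P" by measurable
      then have "emeasure P {x \<in> space P. Z (y x) (w x) \<in> A \<and> y x + w x \<in> B} =
          (\<integral>\<^sup>+x. indicator {x \<in> space P. Z (y x) (w x) \<in> A \<and> y x + w x \<in> B} x \<partial>P)"
        by simp
      also have "\<dots> = (\<integral>\<^sup>+x. indicator A (Z (y x) (w x)) * indicator B (y x + w x) \<partial>P)"
        by (intro nn_integral_cong) (auto split: split_indicator)
      finally show ?thesis .
    qed
    also have "\<dots> = (\<integral>\<^sup>+p. (case p of (a, b) \<Rightarrow> ennreal (?f a) * ennreal (?g b)) *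
        (indicator A (Z (fst p) (snd p)) * indicator B (fst p + snd p)) \<partial>(lborel \<Otimes>\<^sub>M lborel))"
      using distributed_nn_integral[OF joint meas, symmetric] by (simp only: fst_conv snd_conv)
    also have "\<dots> = (\<integral>\<^sup>+p. F (Z (fst p) (snd p)) (fst p + snd p) \<partial>(lborel \<Otimes>\<^sub>M lborel))"
    proof (intro nn_integral_cong)
      fix p :: "(real^'n) \<times> (real^'n)"
      have "ennreal (?f a) * ennreal (?g b) = ennreal (?f' (Z a b)) * ennreal (?g' (a + b))" for a b
        using mvn_density_product_rotate[OF s \<alpha>, of m a b] s \<alpha>
        by (simp add: nn Z_def flip: ennreal_mult)
      then show "(case p of (a, b) \<Rightarrow> ennreal (?f a) * ennreal (?g b)) *
          (indicator A (Z (fst p) (snd p)) * indicator B (fst p + snd p)) =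
          F (Z (fst p) (snd p)) (fst p + snd p)"
        by (simp add: F_def split_beta mult_ac)
    qed
    also have "\<dots> = (\<integral>\<^sup>+a. \<integral>\<^sup>+b. F (Z a b) (a + b) \<partial>lborel \<partial>lborel)"
      by (subst lborel.nn_integral_fst[symmetric]) simp_all
    also have "\<dots> = (\<integral>\<^sup>+a. \<integral>\<^sup>+b. F (a + c b) b \<partial>lborel \<partial>lborel)"
    proof (rule nn_integral_cong)
      fix a :: "real^'n"
      \<comment> \<open>For fixed \<open>a\<close>, this shift turns the inner variable from the
        noise into the sum.\<close>
      have "(\<integral>\<^sup>+b. F (Z a b) (a + b) \<partial>lborel) = (\<integral>\<^sup>+b. F (Z a ((b + a) - a)) (b + a) \<partial>lborel)"
        by (simp only: add_diff_cancel_right' add.commute[of a])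
      also have "\<dots> = (\<integral>\<^sup>+b. F (Z a (b - a)) b \<partial>lborel)"
        by (rule nn_integral_lborel_shift) measurable
      finally show "(\<integral>\<^sup>+b. F (Z a b) (a + b) \<partial>lborel) = (\<integral>\<^sup>+b. F (a + c b) b \<partial>lborel)"
        by (simp only: Zc)
    qed
    \<comment> \<open>The shift \<open>c b\<close> is constant only for fixed \<open>b\<close>, so
      the order of integration is exchanged for the second translation and restored
      afterwards.\<close>
    also have "\<dots> = (\<integral>\<^sup>+b. \<integral>\<^sup>+a. F (a + c b) b \<partial>lborel \<partial>lborel)"
      by (rule lborel_pair.Fubini'[symmetric]) simp
    also have "\<dots> = (\<integral>\<^sup>+b. \<integral>\<^sup>+a. F a b \<partial>lborel \<partial>lborel)"
      by (rule nn_integral_cong, rule nn_integral_lborel_shift) measurable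
    also have "\<dots> = (\<integral>\<^sup>+a. \<integral>\<^sup>+b. F a b \<partial>lborel \<partial>lborel)"
      by (rule lborel_pair.Fubini') simp
    also have "\<dots> = (\<integral>\<^sup>+a. (\<integral>\<^sup>+b. (case (a, b) of (a, b) \<Rightarrow> ennreal (?f' a) * ennreal (?g' b)) *
        indicator B b \<partial>lborel) * indicator A a \<partial>lborel)"
      unfolding F_def by (simp add: nn_integral_multc)
    finally show "emeasure P {x \<in> space P. Z (y x) (w x) \<in> A \<and> y x + w x \<in> B} = \<dots>" .
  qed (simp_all add: sigma_finite_lborel)
  then show ?thesis by (simp add: Z_def)
qed

section \<open>Independence: from product densities and under measurable maps\<close>

lemma distributed_product_densityD:
  assumes "prob_space P" and S: "sigma_finite_measure S" and T: "sigma_finite_measure T"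
    and XY: "distributed P (S \<Otimes>\<^sub>M T) (\<lambda>x. (X x, Y x)) (\<lambda>(a, b). f a * g b)"
    and f: "f \<in> borel_measurable S" "(\<integral>\<^sup>+a. f a \<partial>S) = 1"
    and g: "g \<in> borel_measurable T" "(\<integral>\<^sup>+b. g b \<partial>T) = 1"
  shows "distributed P S X f" "distributed P T Y g" "prob_space.indep_var P S X T Y"
proof -
  interpret prob_space P by fact
  show X: "distributed P S X f"
    using distr_marginal1[OF S T XY] f g by (simp add: nn_integral_cmult)
  show Y: "distributed P T Y g"
    using distr_marginal2[OF S T XY] f g by (simp add: nn_integral_multc)
  \<comment> \<open>The product of two densities is a density of the product only under
    sigma-finiteness; here \<open>density T g\<close> is the law of \<open>Y\<close>, a probability
    measure.\<close>
  have "sigma_finite_measure (density T g)"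
    using prob_space_distr[OF distributed_measurable[OF Y]]
    by (simp add: distributed_distr_eq_density[OF Y] prob_space_imp_sigma_finite)
  then show "indep_var S X T Y"
    using distributed_measurable[OF X] distributed_measurable[OF Y] f(1) g(1) T
    by (simp add: indep_var_distribution_eq distributed_distr_eq_density[OF X]
        distributed_distr_eq_density[OF Y] distributed_distr_eq_density[OF XY] pair_measure_density)
qed

text \<open>Preimages under \<open>f\<close> after \<open>U\<close> are preimages under
  \<open>U\<close>, and the latter already form a sigma-algebra, so generating
  \<open>sigma_sets\<close> stays inside the independent families. This turns independence of
  \<open>ynew\<close> from a pair into independence of real-valued functions of them.\<close>

lemma indep_rv_imp_indep_var_compose:
  assumes "prob_space P" and UV: "indep_rv P S U T V"
    and f: "f \<in> S \<rightarrow>\<^sub>M N" and g: "g \<in> T \<rightarrow>\<^sub>M N'"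
  shows "prob_space.indep_var P N (\<lambda>x. f (U x)) N' (\<lambda>x. g (V x))"
proof -
  interpret prob_space P by fact
  have U: "U \<in> P \<rightarrow>\<^sub>M S" and V: "V \<in> P \<rightarrow>\<^sub>M T"
    and ind: "indep_set {U -` A \<inter> space P | A. A \<in> sets S} {V -` B \<inter> space P | B. B \<in> sets T}"
    using UV by (auto simp: indep_rv_def)
  have sub: "sigma_sets (space P) {(\<lambda>x. h (W x)) -` A \<inter> space P | A. A \<in> sets K} \<subseteq>
      {W -` A \<inter> space P | A. A \<in> sets R}"
    if h: "h \<in> R \<rightarrow>\<^sub>M K" and W: "W \<in> P \<rightarrow>\<^sub>M R" for h W and K :: "'z measure" and R :: "'y measure"
  proof -
    have "sets (vimage_algebra (space P) W R) = {W -` A \<inter> space P | A. A \<in> sets R}"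
      using W by (intro sets_vimage_algebra2) (auto dest: measurable_space)
    moreover have "{(\<lambda>x. h (W x)) -` A \<inter> space P | A. A \<in> sets K} \<subseteq> {W -` A \<inter> space P | A. A \<in> sets R}"
    proof clarify
      fix A assume "A \<in> sets K"
      then have "h -` A \<inter> space R \<in> sets R" using h by (rule measurable_sets[rotated])
      moreover have "(\<lambda>x. h (W x)) -` A \<inter> space P = W -` (h -` A \<inter> space R) \<inter> space P"
        using measurable_space[OF W] by auto
      ultimately show "\<exists>A'. (\<lambda>x. h (W x)) -` A \<inter> space P = W -` A' \<inter> space P \<and> A' \<in> sets R"
        by blast
    qed
    ultimately show ?thesis
      using sets.sigma_sets_subset[of _ "vimage_algebra (space P) W R"] by simp
  qed
  have "indep_set (sigma_sets (space P) {(\<lambda>x. f (U x)) -` A \<inter> space P | A. A \<in> sets N})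
      (sigma_sets (space P) {(\<lambda>x. g (V x)) -` A \<inter> space P | A. A \<in> sets N'})"
    using subsetD[OF sub[OF f U]] subsetD[OF sub[OF g V]] ind
    unfolding indep_sets2_eq by (meson subset_iff)
  then show ?thesis
    unfolding indep_var_eq using measurable_compose[OF U f] measurable_compose[OF V g]
    by (intro conjI)
qed

section \<open>Integrability of products and expansion of the squared error\<close>

lemma indep_var_has_bochner_integral_mult:
  fixes X Y :: "'a \<Rightarrow> real"
  assumes "prob_space P" "prob_space.indep_var P borel X borel Y"
    and "has_bochner_integral P X a" "has_bochner_integral P Y b"
  shows "has_bochner_integral P (\<lambda>x. X x * Y x) (a * b)"
proof -
  interpret prob_space P by fact
  show ?thesis
    using assms indep_var_integrable[of X Y] indep_var_lebesgue_integral[of X Y]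
    by (simp add: has_bochner_integral_iff)
qed

lemma integrable_mult_square_integrable:
  fixes f g :: "'a \<Rightarrow> real"
  assumes [measurable]: "f \<in> borel_measurable M" "g \<in> borel_measurable M"
    and "integrable M (\<lambda>x. (f x)\<^sup>2)" "integrable M (\<lambda>x. (g x)\<^sup>2)"
  shows "integrable M (\<lambda>x. f x * g x)"
proof (rule Bochner_Integration.integrable_bound)
  show "integrable M (\<lambda>x. (f x)\<^sup>2 + (g x)\<^sup>2)" using assms by simp
  have "\<bar>a * b\<bar> \<le> a\<^sup>2 + b\<^sup>2" for a b :: real
    using sum_squares_bound[of a b] sum_squares_bound[of a "- b"] by (simp add: abs_le_iff)
  then show "AE x in M. norm (f x * g x) \<le> norm ((f x)\<^sup>2 + (g x)\<^sup>2)" by simp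
qed simp

text \<open>In the main argument \<open>g\<close> is built from entries of the selected hat matrix,
  which are bounded because there are finitely many models.\<close>

lemma integrable_mult_bounded:
  fixes f g :: "'a \<Rightarrow> real"
  assumes f: "integrable M f" and [measurable]: "g \<in> borel_measurable M"
    and "\<And>x. \<bar>g x\<bar> \<le> B"
  shows "integrable M (\<lambda>x. g x * f x)"
proof (rule Bochner_Integration.integrable_bound)
  show "integrable M (\<lambda>x. B * f x)" using f by simp
  show "(\<lambda>x. g x * f x) \<in> borel_measurable M" using f by simp
  have "\<bar>g x * f x\<bar> \<le> \<bar>B * f x\<bar>" for x
    using order_trans[OF assms(3)[of x] abs_ge_self] by (simp add: abs_mult mult_right_mono)
  then show "AE x in M. norm (g x * f x) \<le> norm (B * f x)" by simp
qed

text \<open>Applied with \<open>p\<close> equal to \<open>y\<^sup>-\<close> and to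
  \<open>ynew\<close>, the expansion isolates what differs: the last sum is free of \<open>p\<close>
  and therefore common to estimator and target.\<close>

lemma norm_diff_matrix_vector_mult_sq:
  fixes p q :: "real^'n" and A :: "real^'n^'n"
  shows "(norm (p - A *v q))\<^sup>2 = (\<Sum>i\<in>UNIV. (p $ i)\<^sup>2)
    - 2 * (\<Sum>i\<in>UNIV. \<Sum>j\<in>UNIV. p $ i * (A $ i $ j * q $ j))
    + (\<Sum>i\<in>UNIV. \<Sum>j\<in>UNIV. \<Sum>k\<in>UNIV. (A $ i $ j * A $ i $ k) * (q $ j * q $ k))"
proof -
  have "(norm (p - A *v q))\<^sup>2 = p \<bullet> p - 2 * (p \<bullet> (A *v q)) + (A *v q) \<bullet> (A *v q)"
    by (simp add: power2_norm_eq_inner inner_diff inner_commute)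
  also have "p \<bullet> p = (\<Sum>i\<in>UNIV. (p $ i)\<^sup>2)"
    by (simp add: inner_vec_def power2_eq_square)
  also have "p \<bullet> (A *v q) = (\<Sum>i\<in>UNIV. \<Sum>j\<in>UNIV. p $ i * (A $ i $ j * q $ j))"
    by (simp add: inner_vec_def matrix_vector_mult_def sum_distrib_left)
  also have "(A *v q) \<bullet> (A *v q) =
      (\<Sum>i\<in>UNIV. \<Sum>j\<in>UNIV. \<Sum>k\<in>UNIV. (A $ i $ j * A $ i $ k) * (q $ j * q $ k))"
    by (simp add: inner_vec_def matrix_vector_mult_def sum_product mult_ac)
  finally show ?thesis .
qed

section \<open>Second moments and the cross term with the randomized response\<close>

lemma distributed_mvn_second_moment:
  fixes X :: "'a \<Rightarrow> real^'n"
  assumes "prob_space P"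
    and X: "distributed P lborel X (mvn_density m (s *\<^sub>R mat 1))" and s: "s > 0"
  shows "has_bochner_integral P (\<lambda>x. (X x $ a)\<^sup>2) ((m $ a)\<^sup>2 + s)"
proof -
  interpret prob_space P by fact
  have "has_bochner_integral P (\<lambda>x. (X x $ a - m $ a) * (X x $ a - m $ a) + 2 * m $ a * X x $ a + - (m $ a)\<^sup>2)
      (s * of_bool (a = a) + 2 * m $ a * m $ a + - (m $ a)\<^sup>2)"
    by (intro has_bochner_integral_add has_bochner_integral_mult_right
        distributed_mvn_covariance[OF X s] distributed_mvn_mean[OF assms])
      (simp add: has_bochner_integral_iff prob_space)
  then show ?thesis
    by (simp add: power2_eq_square algebra_simps)
qed

text \<open>This is a covariance identity in the spirit of Stein, obtained from independence instead
  of differentiation, so a bounded measurable \<open>g\<close> suffices. Beyond the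
  \<open>m $ i\<close> part, only the product of \<open>z $ i\<close>, \<open>z $ j\<close> and
  \<open>g u\<close> has nonzero mean.\<close>

lemma has_bochner_integral_randomized_cross_term:
  fixes y w :: "'a \<Rightarrow> real^'n" and g :: "real^'n \<Rightarrow> real"
  assumes "prob_space P" and s: "s > 0" and \<alpha>: "\<alpha> > 0"
    and y: "distributed P lborel y (mvn_density m (s *\<^sub>R mat 1))"
    and w: "distributed P lborel w (mvn_density 0 ((\<alpha> * s) *\<^sub>R mat 1))"
    and indep: "prob_space.indep_var P borel y borel w"
    and g [measurable]: "g \<in> borel_measurable borel" and B: "\<And>v. \<bar>g v\<bar> \<le> B"
  shows "has_bochner_integral P (\<lambda>x. (y x - (1 / \<alpha>) *\<^sub>R w x) $ i * (g (y x + w x) * y x $ j))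
    (m $ i * (\<integral>x. g (y x + w x) * y x $ j \<partial>P) + s * of_bool (i = j) * (\<integral>x. g (y x + w x) \<partial>P))"
    and "has_bochner_integral P (\<lambda>x. ((y x - (1 / \<alpha>) *\<^sub>R w x) $ i)\<^sup>2) ((m $ i)\<^sup>2 + s + s / \<alpha>)"
proof -
  interpret prob_space P by fact
  define r where "r = 1 + \<alpha>"
  define z where "z x = (1 / r) *\<^sub>R (\<alpha> *\<^sub>R (y x - m) - w x)" for x
  define u where "u x = y x + w x" for x
  \<comment> \<open>\<open>h u\<close> is the conditional mean of \<open>y\<close> given
    \<open>u\<close>, and \<open>z\<close> is the centered residual independent of
    \<open>u\<close>.\<close>
  define h where "h v = (1 / r) *\<^sub>R (v + \<alpha> *\<^sub>R m)" for v :: "real^'n"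
  have r: "r > 0" using \<alpha> by (simp add: r_def)
  have "distributed P (lborel \<Otimes>\<^sub>M lborel) (\<lambda>x. (z x, u x))
      (\<lambda>(a, b). ennreal (mvn_density 0 ((\<alpha> * s / r) *\<^sub>R mat 1) a) *
        ennreal (mvn_density m ((r * s) *\<^sub>R mat 1) b))"
    unfolding z_def u_def r_def by (rule distributed_mvn_rotate) fact+
  note zu = distributed_product_densityD[OF \<open>prob_space P\<close> sigma_finite_lborel sigma_finite_lborel this]
  have [measurable]: "mvn_density 0 ((\<alpha> * s / r) *\<^sub>R mat 1 :: real^'n^'n) \<in> borel_measurable borel"
    "mvn_density m ((r * s) *\<^sub>R mat 1) \<in> borel_measurable borel"
    using r s \<alpha> by (simp_all add: borel_measurable_mvn_density)
  have z: "distributed P lborel z (mvn_density 0 ((\<alpha> * s / r) *\<^sub>R mat 1))"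
    and u: "distributed P lborel u (mvn_density m ((r * s) *\<^sub>R mat 1))"
    and "indep_var lborel z lborel u"
    using r s \<alpha> by (auto intro!: zu simp: nn_integral_mvn_density)
  then have zu: "indep_var borel z borel u" by (simp add: indep_var_eq)
  have s': "\<alpha> * s / r > 0" and rs: "r * s > 0" using r s \<alpha> by auto
  have [measurable]: "u \<in> borel_measurable P" "y \<in> borel_measurable P"
    using distributed_measurable[OF u] distributed_measurable[OF y] by simp_all
  have bounded: "integrable P (\<lambda>x. g (u x) * f x)" if "integrable P f" for f
    using that by (rule integrable_mult_bounded[where B = B]) (simp_all add: B)
  have iu: "integrable P (\<lambda>x. g (u x))"
    using bounded[of "\<lambda>_. 1"] by simp
  have ih: "integrable P (\<lambda>x. h (u x) $ j)"
    using distributed_mvn_mean[OF \<open>prob_space P\<close> u rs, of j]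
    by (auto simp: h_def has_bochner_integral_iff)
  have iy: "integrable P (\<lambda>x. y x $ j)"
    using distributed_mvn_mean[OF \<open>prob_space P\<close> y s, of j] by (simp add: has_bochner_integral_iff)
  \<comment> \<open>The factor \<open>1 / \<alpha>\<close> is exactly the one for which this vector
    is a function of \<open>z\<close> alone, hence independent of the selection.\<close>
  have v_eq: "y x - (1 / \<alpha>) *\<^sub>R w x = m + (r / \<alpha>) *\<^sub>R z x" for x
    using r \<alpha> by (simp add: z_def algebra_simps)
  have y_eq: "y x = h (u x) + z x" for x
  proof -
    have "h (u x) + z x = (1 / r) *\<^sub>R (r *\<^sub>R y x)"
      unfolding h_def z_def u_def scaleR_add_right[symmetric]
      by (simp add: r_def algebra_simps)
    then show ?thesis using r by simp
  qed
  have "indep_var borel ((\<lambda>a. a $ i) \<circ> z) borel ((\<lambda>v. g v * h v $ j) \<circ> u)"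
    by (rule indep_var_compose[OF zu]) (simp_all add: h_def)
  \<comment> \<open>The leading 0 is the mean of \<open>z $ i\<close>, which is independent of
    everything computed from \<open>u\<close>.\<close>
  then have 1: "has_bochner_integral P (\<lambda>x. z x $ i * (g (u x) * h (u x) $ j))
      (0 * (\<integral>x. g (u x) * h (u x) $ j \<partial>P))"
    unfolding comp_def
    using distributed_mvn_mean[OF \<open>prob_space P\<close> z s', of i] bounded[OF ih]
    by - (rule indep_var_has_bochner_integral_mult[OF \<open>prob_space P\<close>],
      simp_all add: has_bochner_integral_iff)
  have "indep_var borel ((\<lambda>a. a $ i * a $ j) \<circ> z) borel (g \<circ> u)"
    by (rule indep_var_compose[OF zu]) simp_all
  then have 2: "has_bochner_integral P (\<lambda>x. (z x $ i * z x $ j) * g (u x))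
      ((\<alpha> * s / r * of_bool (i = j)) * (\<integral>x. g (u x) \<partial>P))"
    unfolding comp_def using distributed_mvn_covariance[OF z s', of i j] iu
    by - (rule indep_var_has_bochner_integral_mult[OF \<open>prob_space P\<close>],
      simp_all add: has_bochner_integral_iff)
  have 3: "has_bochner_integral P (\<lambda>x. g (u x) * y x $ j) (\<integral>x. g (u x) * y x $ j \<partial>P)"
    using bounded[OF iy] by (simp add: has_bochner_integral_iff)
  have "has_bochner_integral P
      (\<lambda>x. m $ i * (g (u x) * y x $ j) + r / \<alpha> * (z x $ i * (g (u x) * h (u x) $ j) + (z x $ i * z x $ j) * g (u x)))
      (m $ i * (\<integral>x. g (u x) * y x $ j \<partial>P) + r / \<alpha> * (0 * (\<integral>x. g (u x) * h (u x) $ j \<partial>P) +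
        (\<alpha> * s / r * of_bool (i = j)) * (\<integral>x. g (u x) \<partial>P)))"
    by (intro has_bochner_integral_add has_bochner_integral_mult_right 1 2 3)
  moreover have "m $ i * (g (u x) * y x $ j) +
      r / \<alpha> * (z x $ i * (g (u x) * h (u x) $ j) + (z x $ i * z x $ j) * g (u x)) =
      (y x - (1 / \<alpha>) *\<^sub>R w x) $ i * (g (u x) * y x $ j)" for x
    unfolding v_eq by (simp add: y_eq[of x] algebra_simps)
  \<comment> \<open>The scale \<open>r / \<alpha>\<close> and the variance
    \<open>\<alpha> * s / r\<close> of \<open>z\<close> multiply to \<open>s\<close>, so the
    correction does not depend on \<open>\<alpha>\<close>.\<close>
  moreover have "r / \<alpha> * (0 * a + (\<alpha> * s / r * of_bool (i = j)) * b) = s * of_bool (i = j) * b" for a b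
    using r \<alpha> by simp
  ultimately show "has_bochner_integral P (\<lambda>x. (y x - (1 / \<alpha>) *\<^sub>R w x) $ i * (g (y x + w x) * y x $ j))
    (m $ i * (\<integral>x. g (y x + w x) * y x $ j \<partial>P) + s * of_bool (i = j) * (\<integral>x. g (y x + w x) \<partial>P))"
    by (simp only: u_def)
  \<comment> \<open>The square of \<open>m $ i + r / \<alpha> * z $ i\<close> is expanded; each
    \<open>0 $ i\<close> is a mean of \<open>z\<close>.\<close>
  have "has_bochner_integral P (\<lambda>x. (r / \<alpha>)\<^sup>2 * (z x $ i)\<^sup>2 + (2 * m $ i * r / \<alpha> * z x $ i + (m $ i)\<^sup>2))
     ((r / \<alpha>)\<^sup>2 * ((0 $ i)\<^sup>2 + \<alpha> * s / r) + (2 * m $ i * r / \<alpha> * 0 $ i + (m $ i)\<^sup>2))"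
    by (intro has_bochner_integral_add has_bochner_integral_mult_right
        distributed_mvn_second_moment[OF \<open>prob_space P\<close> z s'] distributed_mvn_mean[OF \<open>prob_space P\<close> z s'])
      (simp add: has_bochner_integral_iff prob_space)
  moreover have "(r / \<alpha>)\<^sup>2 * (z x $ i)\<^sup>2 + (2 * m $ i * r / \<alpha> * z x $ i + (m $ i)\<^sup>2) =
      ((y x - (1 / \<alpha>) *\<^sub>R w x) $ i)\<^sup>2" for x
    unfolding v_eq by (simp add: power2_eq_square algebra_simps)
  moreover have "(r / \<alpha>)\<^sup>2 * (\<alpha> * s / r) = s + s / \<alpha>"
    using r \<alpha> by (simp add: power2_eq_square field_simps) (simp add: r_def algebra_simps)
  ultimately show "has_bochner_integral P (\<lambda>x. ((y x - (1 / \<alpha>) *\<^sub>R w x) $ i)\<^sup>2) ((m $ i)\<^sup>2 + s + s / \<alpha>)"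
    by (simp add: algebra_simps)
qed

section \<open>Unbiasedness of the estimator\<close>

theorem theorem2p1:
  fixes P :: "'a measure"
    and y \<omega> ynew :: "'a \<Rightarrow> real^'n"
    and \<mu> :: "real^'n"
    and \<sigma> \<alpha> :: real
    and MM :: "'m set"
    and Mhat :: "real^'n \<Rightarrow> 'm"
    and H :: "'m \<Rightarrow> real^'n^'n"
  assumes "prob_space P"
    and "\<sigma>\<^sup>2 > 0"
    and "\<alpha> > 0"
    and "finite MM"
    and "Mhat \<in> borel \<rightarrow>\<^sub>M count_space MM"
    and "distributed P lborel y (mvn_density \<mu> (\<sigma>\<^sup>2 *\<^sub>R mat 1))"
    and "distributed P lborel \<omega> (mvn_density 0 ((\<alpha> * \<sigma>\<^sup>2) *\<^sub>R mat 1))"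
    and "indep_rv P borel y borel \<omega>"
    and "distributed P lborel ynew (mvn_density \<mu> (\<sigma>\<^sup>2 *\<^sub>R mat 1))"
    and "indep_rv P borel ynew (borel \<Otimes>\<^sub>M borel) (\<lambda>x. (y x, \<omega> x))"
  shows "integrable P (\<lambda>x. err_hat H Mhat \<sigma> \<alpha> (y x) (\<omega> x))
    \<and> integrable P (\<lambda>x. (norm (ynew x - H (Mhat (y x + \<omega> x)) *v y x))\<^sup>2)
    \<and> prob_space.expectation P (\<lambda>x. err_hat H Mhat \<sigma> \<alpha> (y x) (\<omega> x))
      = prob_space.expectation P (\<lambda>x. (norm (ynew x - H (Mhat (y x + \<omega> x)) *v y x))\<^sup>2)"

proof -
  interpret prob_space P by fact
  define s where "s = \<sigma>\<^sup>2"
  have s: "s > 0" and s\<alpha>: "\<alpha> * s > 0" using assms(2,3) by (simp_all add: s_def)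
  note y = assms(6)[folded s_def] and w = assms(7)[folded s_def] and ynew = assms(9)[folded s_def]
  have indep: "indep_var borel y borel \<omega>"
    using indep_rv_imp_indep_var_compose[OF assms(1,8), of "\<lambda>v. v" borel "\<lambda>v. v" borel] by simp
  define u where "u x = y x + \<omega> x" for x
  define v where "v x = y x - (1 / \<alpha>) *\<^sub>R \<omega> x" for x
  define G where "G a = H (Mhat a)" for a
  have [measurable]: "y \<in> borel_measurable P" "\<omega> \<in> borel_measurable P" "u \<in> borel_measurable P"
    using distributed_measurable[OF y] distributed_measurable[OF w] by (simp_all add: u_def[abs_def])
  \<comment> \<open>Every function on \<open>count_space MM\<close> is measurable, so
    \<open>G\<close> inherits measurability from \<open>Mhat\<close>.\<close>
  have "G \<in> borel_measurable borel"
    unfolding G_def[abs_def] by (rule measurable_compose[OF assms(5)]) simp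
  moreover have "(\<lambda>A :: real^'n^'n. A $ i $ j) \<in> borel_measurable borel" for i j
    by (intro borel_measurable_continuous_onI continuous_intros)
  ultimately have [measurable]: "(\<lambda>a. G a $ i $ j) \<in> borel_measurable borel" for i j
    by (rule measurable_compose)
  \<comment> \<open>The sum of the norms over the finite set \<open>MM\<close> bounds all entries of
    all selectable matrices at once.\<close>
  obtain B where B: "\<bar>G a $ i $ j\<bar> \<le> B" for a i j
  proof
    fix a and i j :: 'n
    have "Mhat a \<in> MM" using measurable_space[OF assms(5), of a] by simp
    then have "norm (G a) \<le> (\<Sum>M\<in>MM. norm (H M))"
      unfolding G_def using assms(4) by (intro member_le_sum) auto
    moreover have "\<bar>G a $ i $ j\<bar> \<le> norm (G a)"
      using component_le_norm_cart[of "G a $ i" j] Finite_Cartesian_Product.norm_nth_le[of "G a" i] by simp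
    ultimately show "\<bar>G a $ i $ j\<bar> \<le> (\<Sum>M\<in>MM. norm (H M))" by simp
  qed
  have Bs: "B \<ge> 0" by (rule order_trans[OF abs_ge_zero B])
  have bounded: "integrable P (\<lambda>x. G (u x) $ i $ j * f x)" if "integrable P f" for f i j
    using that by (rule integrable_mult_bounded[where B = B]) (simp_all add: B)
  have iG: "integrable P (\<lambda>x. G (u x) $ i $ j)" for i j
    using bounded[of "\<lambda>_. 1"] by simp
  have iy: "integrable P (\<lambda>x. y x $ j)" for j
    using distributed_mvn_mean[OF assms(1) y s, of j] by (simp add: has_bochner_integral_iff)
  \<comment> \<open>Here \<open>b\<close> is the inner product of \<open>\<mu>\<close> with the mean
    of \<open>G u *v y\<close>, \<open>t\<close> is the expected trace, and \<open>q\<close> is the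
    squared norm of \<open>G u *v y\<close>. The mean of \<open>q\<close> stays unevaluated, since
    it occurs on both sides.\<close>
  define e where "e i j = (\<integral>x. G (u x) $ i $ j * y x $ j \<partial>P)" for i j
  define t where "t = (\<Sum>i\<in>UNIV. \<integral>x. G (u x) $ i $ i \<partial>P)"
  define b where "b = (\<Sum>i\<in>UNIV. \<Sum>j\<in>UNIV. \<mu> $ i * e i j)"
  define q where "q x = (\<Sum>i\<in>UNIV. \<Sum>j\<in>UNIV. \<Sum>k\<in>UNIV.
    (G (u x) $ i $ j * G (u x) $ i $ k) * (y x $ j * y x $ k))" for x
  have q: "has_bochner_integral P q (\<integral>x. q x \<partial>P)"
  proof -
    have "integrable P (\<lambda>x. y x $ j * y x $ k)" for j k
      using distributed_mvn_second_moment[OF assms(1) y s] borel_measurable_integrable[OF iy]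
      by (intro integrable_mult_square_integrable) (auto simp: has_bochner_integral_iff)
    moreover have "\<bar>G a $ i $ j * G a $ i $ k\<bar> \<le> B * B" for a i j k
      unfolding abs_mult by (intro mult_mono B Bs) simp
    ultimately have "integrable P (\<lambda>x. (G (u x) $ i $ j * G (u x) $ i $ k) * (y x $ j * y x $ k))" for i j k
      by - (rule integrable_mult_bounded[where B = "B * B"], simp_all)
    then show ?thesis by (simp add: q_def[abs_def] has_bochner_integral_iff)
  qed
  have trace: "has_bochner_integral P (\<lambda>x. trace (G (u x))) t"
    unfolding trace_def t_def using iG by (intro has_bochner_integral_sum) (simp add: has_bochner_integral_iff)
  have *: "has_bochner_integral P (\<lambda>x. \<Sum>i\<in>UNIV. \<Sum>j\<in>UNIV. v x $ i * (G (u x) $ i $ j * y x $ j))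
      (\<Sum>i\<in>UNIV. \<Sum>j\<in>UNIV. \<mu> $ i * e i j + s * of_bool (i = j) * (\<integral>x. G (u x) $ i $ j \<partial>P))"
    unfolding v_def u_def e_def
    by (intro has_bochner_integral_sum has_bochner_integral_randomized_cross_term(1)
        [OF assms(1) s assms(3) y w indep, where B = B]) (simp_all add: B)
  have cross: "has_bochner_integral P
      (\<lambda>x. \<Sum>i\<in>UNIV. \<Sum>j\<in>UNIV. v x $ i * (G (u x) $ i $ j * y x $ j)) (b + s * t)"
  proof -
    \<comment> \<open>Written as a conditional, the Kronecker delta collapses the double sum to its
      diagonal, which is the trace.\<close>
    have "s * of_bool (i = j) * c = (if i = j then s * c else 0)" for i j :: 'n and c
      by simp
    then show ?thesis
      using * by (simp only: sum.distrib sum.delta' finite b_def t_def sum_distrib_left)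
        simp
  qed
  \<comment> \<open>This second moment involves \<open>v\<close> only, so the zero function with
    bound 0 instantiates \<open>g\<close>.\<close>
  have v: "has_bochner_integral P (\<lambda>x. \<Sum>i\<in>UNIV. (v x $ i)\<^sup>2) (\<Sum>i\<in>UNIV. (\<mu> $ i)\<^sup>2 + s + s / \<alpha>)"
    unfolding v_def
    by (intro has_bochner_integral_sum has_bochner_integral_randomized_cross_term(2)
        [OF assms(1) s assms(3) y w indep, of "\<lambda>_. 0" 0]) simp_all
  \<comment> \<open>\<open>ynew\<close> is independent of the pair of data and noise, hence of the
    fitted value; the expectation factors and no trace term arises.\<close>
  have "has_bochner_integral P (\<lambda>x. ynew x $ i * (G (u x) $ i $ j * y x $ j)) (\<mu> $ i * e i j)" for i j
  proof (rule indep_var_has_bochner_integral_mult[OF assms(1)])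
    have [measurable]: "(\<lambda>a :: real^'n. a $ j) \<in> borel_measurable borel"
      by simp
    have "(\<lambda>p. G (fst p + snd p) $ i $ j * fst p $ j) \<in> borel_measurable (borel \<Otimes>\<^sub>M borel)"
      by measurable
    from indep_rv_imp_indep_var_compose[OF assms(1,10) _ this, of "\<lambda>a. a $ i" borel]
    show "indep_var borel (\<lambda>x. ynew x $ i) borel (\<lambda>x. G (u x) $ i $ j * y x $ j)"
      by (simp add: u_def)
    show "has_bochner_integral P (\<lambda>x. ynew x $ i) (\<mu> $ i)"
      by (rule distributed_mvn_mean[OF assms(1) ynew s])
    show "has_bochner_integral P (\<lambda>x. G (u x) $ i $ j * y x $ j) (e i j)"
      using bounded[OF iy] by (simp add: has_bochner_integral_iff e_def)
  qed
  then have cross_new: "has_bochner_integral P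
      (\<lambda>x. \<Sum>i\<in>UNIV. \<Sum>j\<in>UNIV. ynew x $ i * (G (u x) $ i $ j * y x $ j)) b"
    unfolding b_def by (intro has_bochner_integral_sum)
  have new: "has_bochner_integral P (\<lambda>x. \<Sum>i\<in>UNIV. (ynew x $ i)\<^sup>2) (\<Sum>i\<in>UNIV. (\<mu> $ i)\<^sup>2 + s)"
    by (intro has_bochner_integral_sum distributed_mvn_second_moment[OF assms(1) ynew s])
  let ?n = "real CARD('n)"
  have "has_bochner_integral P (\<lambda>x. err_hat H Mhat \<sigma> \<alpha> (y x) (\<omega> x))
      ((\<Sum>i\<in>UNIV. (\<mu> $ i)\<^sup>2 + s + s / \<alpha>) - 2 * (b + s * t) + (\<integral>x. q x \<partial>P) + 2 * t * s - 1 / \<alpha> * ?n * s)"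
    unfolding err_hat_def norm_diff_matrix_vector_mult_sq
    unfolding s_def[symmetric] u_def[symmetric] v_def[symmetric] G_def[symmetric] q_def[symmetric]
    by (intro has_bochner_integral_add has_bochner_integral_diff has_bochner_integral_mult_right
        has_bochner_integral_mult_left v cross q trace) (simp add: has_bochner_integral_iff prob_space)
  moreover have "has_bochner_integral P (\<lambda>x. (norm (ynew x - H (Mhat (y x + \<omega> x)) *v y x))\<^sup>2)
      ((\<Sum>i\<in>UNIV. (\<mu> $ i)\<^sup>2 + s) - 2 * b + (\<integral>x. q x \<partial>P))"
    unfolding norm_diff_matrix_vector_mult_sq u_def[symmetric] G_def[symmetric] q_def[symmetric]
    by (intro has_bochner_integral_add has_bochner_integral_diff has_bochner_integral_mult_right
        new cross_new q)
  \<comment> \<open>The trace correction cancels \<open>- 2 * (s * t)\<close> from the cross term,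
    and the last correction cancels the \<open>s / \<alpha>\<close> summed over the
    coordinates.\<close>
  moreover have "(\<Sum>i\<in>UNIV. (\<mu> $ i)\<^sup>2 + s + s / \<alpha>) - 2 * (b + s * t) + (\<integral>x. q x \<partial>P) + 2 * t * s - 1 / \<alpha> * ?n * s =
      (\<Sum>i\<in>UNIV. (\<mu> $ i)\<^sup>2 + s) - 2 * b + (\<integral>x. q x \<partial>P)"
    by (simp add: sum.distrib algebra_simps)
  ultimately show ?thesis
    by (simp add: has_bochner_integral_iff)
qed

end
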